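(* Let $n\ge 5$, $2\le i\le\lfloor n/2\rfloor$, $2\le j\le\lceil n/2\rceil$, $j\neq i$. The subgroup $\mathbf{Z}_{E_{i,j}}$ of the $n\times n\times n$ Rubik's Cube group $\mathbf{G}$ consisting of the elements that fix every facelet outside the center edge orbit $(i,j)$ is isomorphic to the alternating group $\mathcal{A}_{24}$ (both for odd and for even $n$).
   Context: The $n\times n\times n$ Rubik's Cube has faces U, D, F, B, R, L, each an $n\times n$ grid of facelets carrying stickers ($6n^2$ in total). For $1\le k\le\lfloor n/2\rfloor$, $F_k,B_k,R_k,L_k,U_k,D_k$ denote clockwise (seen from the named face) $90^\circ$ rotations of the $k$-th $n\times n\times 1$ slice counted from the named face. $\mathbf{G}$ is the subgroup of the symmetric group on the facelets generated by the facelet permutations induced by these moves. On each face index facelets by $(r,c)$, $1\le r,c\le n$ (as seen from outside). The center edge orbit $(i,j)$ is the set of 24 facelets which on each of the six faces occupy the four positions $(i,j),(j,n+1-i),(n+1-i,n+1-j),(n+1-j,i)$ (these belong to one-sticker center cubies). *)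

theory Defs
  imports "HOL-Algebra.Bij" "HOL-Algebra.Generated_Groups" "HOL-Algebra.Sym_Groups"
begin

datatype face = Up | Down | Front | Back | Right | Left

text \<open>A facelet is (face, row, column). Rows and columns are counted from the top left corner
  of the face as seen from outside, the six faces being laid out in the usual net
  \<^verbatim>\<open>
          Up
    Left Front Right Back
         Down
  \<close>
  so that, for instance, row n of Up, row 1 of Down, column n of Left and column 1 of Right
  are the lines adjacent to Front, while row 1 of Up and row n of Down are adjacent to Back.\<close>

type_synonym facelet = "face \<times> nat \<times> nat"

definition facelets :: "nat \<Rightarrow> facelet set" where
  "facelets n = UNIV \<times> {1..n} \<times> {1..n}"

text \<open>The effect of a clockwise quarter turn of the k-th slice, counted from the face in the
  second argument, on the four lines of facelets that run around the slice. A facelet is mapped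
  to the place its sticker is carried to.\<close>

fun turn_ring :: "nat \<Rightarrow> face \<Rightarrow> nat \<Rightarrow> facelet \<Rightarrow> facelet" where
  "turn_ring n Up k (Front, r, c) = (if r = k then (Left, r, c) else (Front, r, c))"
| "turn_ring n Up k (Left, r, c) = (if r = k then (Back, r, c) else (Left, r, c))"
| "turn_ring n Up k (Back, r, c) = (if r = k then (Right, r, c) else (Back, r, c))"
| "turn_ring n Up k (Right, r, c) = (if r = k then (Front, r, c) else (Right, r, c))"

| "turn_ring n Down k (Front, r, c) = (if r = n + 1 - k then (Right, r, c) else (Front, r, c))"
| "turn_ring n Down k (Right, r, c) = (if r = n + 1 - k then (Back, r, c) else (Right, r, c))"
| "turn_ring n Down k (Back, r, c) = (if r = n + 1 - k then (Left, r, c) else (Back, r, c))"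
| "turn_ring n Down k (Left, r, c) = (if r = n + 1 - k then (Front, r, c) else (Left, r, c))"

| "turn_ring n Front k (Up, r, c) = (if r = n + 1 - k then (Right, c, k) else (Up, r, c))"
| "turn_ring n Front k (Right, r, c) = (if c = k then (Down, k, n + 1 - r) else (Right, r, c))"
| "turn_ring n Front k (Down, r, c) = (if r = k then (Left, c, n + 1 - k) else (Down, r, c))"
| "turn_ring n Front k (Left, r, c) =
     (if c = n + 1 - k then (Up, n + 1 - k, n + 1 - r) else (Left, r, c))"

| "turn_ring n Back k (Up, r, c) = (if r = k then (Left, n + 1 - c, k) else (Up, r, c))"
| "turn_ring n Back k (Left, r, c) = (if c = k then (Down, n + 1 - k, r) else (Left, r, c))"
| "turn_ring n Back k (Down, r, c) =
     (if r = n + 1 - k then (Right, n + 1 - c, n + 1 - k) else (Down, r, c))"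
| "turn_ring n Back k (Right, r, c) = (if c = n + 1 - k then (Up, k, r) else (Right, r, c))"

| "turn_ring n Right k (Front, r, c) = (if c = n + 1 - k then (Up, r, c) else (Front, r, c))"
| "turn_ring n Right k (Up, r, c) = (if c = n + 1 - k then (Back, n + 1 - r, k) else (Up, r, c))"
| "turn_ring n Right k (Back, r, c) =
     (if c = k then (Down, n + 1 - r, n + 1 - k) else (Back, r, c))"
| "turn_ring n Right k (Down, r, c) = (if c = n + 1 - k then (Front, r, c) else (Down, r, c))"

| "turn_ring n Left k (Front, r, c) = (if c = k then (Down, r, c) else (Front, r, c))"
| "turn_ring n Left k (Down, r, c) = (if c = k then (Back, n + 1 - r, n + 1 - k) else (Down, r, c))"
| "turn_ring n Left k (Back, r, c) = (if c = n + 1 - k then (Up, n + 1 - r, k) else (Back, r, c))"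
| "turn_ring n Left k (Up, r, c) = (if c = k then (Front, r, c) else (Up, r, c))"

| "turn_ring n X k x = x"

text \<open>The outermost slice also carries the facelets of the face itself. (The opposite face is
  never moved, since k is at most n div 2 for the turns used below.)\<close>

definition slice_turn :: "nat \<Rightarrow> face \<Rightarrow> nat \<Rightarrow> facelet \<Rightarrow> facelet" where
  "slice_turn n X k = (\<lambda>(f, r, c).
     if f = X \<and> k = 1 then (f, c, n + 1 - r) else turn_ring n X k (f, r, c))"

definition slice_turns :: "nat \<Rightarrow> (facelet \<Rightarrow> facelet) set" where
  "slice_turns n = {restrict (slice_turn n X k) (facelets n) | X k. 1 \<le> k \<and> k \<le> n div 2}"

definition rubik_group :: "nat \<Rightarrow> (facelet \<Rightarrow> facelet) monoid" where
  "rubik_group n = subgroup_generated (BijGroup (facelets n)) (slice_turns n)"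

definition center_edge_orbit :: "nat \<Rightarrow> nat \<Rightarrow> nat \<Rightarrow> facelet set" where
  "center_edge_orbit n i j =
     UNIV \<times> {(i, j), (j, n + 1 - i), (n + 1 - i, n + 1 - j), (n + 1 - j, i)}"

definition Z_center_edge :: "nat \<Rightarrow> nat \<Rightarrow> nat \<Rightarrow> (facelet \<Rightarrow> facelet) set" where
  "Z_center_edge n i j =
     {g \<in> carrier (rubik_group n). \<forall>x \<in> facelets n - center_edge_orbit n i j. g x = x}"

text \<open>\<^const>\<open>subgroup_generated\<close> discards generators outside the carrier; the following facts
  show that none are lost here.\<close>

lemma slice_turn_in_facelets:
  assumes "1 \<le> k" "k \<le> n div 2" "x \<in> facelets n"
  shows "slice_turn n X k x \<in> facelets n"
proof -
  obtain f r c where x: "x = (f, r, c)" by (cases x)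
  show ?thesis using assms unfolding x
    by (cases X; cases f) (auto simp: slice_turn_def facelets_def)
qed

lemma slice_turn_4:
  assumes "1 \<le> k" "k \<le> n div 2" "x \<in> facelets n"
  shows "slice_turn n X k (slice_turn n X k (slice_turn n X k (slice_turn n X k x))) = x"
proof -
  obtain f r c where x: "x = (f, r, c)" by (cases x)
  show ?thesis using assms unfolding x
    by (cases X; cases f) (auto simp: slice_turn_def facelets_def)
qed

lemma slice_turns_subset_Bij: "slice_turns n \<subseteq> carrier (BijGroup (facelets n))"
proof
  fix g assume "g \<in> slice_turns n"
  then obtain X k where k: "1 \<le> k" "k \<le> n div 2"
    and g: "g = restrict (slice_turn n X k) (facelets n)"
    by (auto simp: slice_turns_def)
  let ?t = "slice_turn n X k"
  have "bij_betw ?t (facelets n) (facelets n)"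
    by (rule bij_betw_byWitness[where f' = "\<lambda>x. ?t (?t (?t x))"])
      (simp_all add: image_subset_iff slice_turn_4[OF k] slice_turn_in_facelets[OF k])
  then show "g \<in> carrier (BijGroup (facelets n))"
    by (simp add: g BijGroup_def Bij_def bij_betw_restrict_eq)
qed

lemma carrier_rubik_group:
  "carrier (rubik_group n) = generate (BijGroup (facelets n)) (slice_turns n)"
  using slice_turns_subset_Bij[of n]
  by (simp add: rubik_group_def carrier_subgroup_generated Int_absorb1)

end

theory Submission
  imports Defs
begin

text \<open>
  Upper bound: a turn of the \<open>k\<close>-th slice acts on the orbit \<open>(a, b)\<close> by 4-cycles, one for each of
  the equations \<open>k = a\<close>, \<open>k = b\<close> and \<open>k = 1\<close> that holds. Hence the product of the signs on the
  orbits \<open>(i, j)\<close>, \<open>(1, 1)\<close>, \<open>(1, i)\<close> and \<open>(1, j)\<close> is 1 for every turn, and so for every group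
  element; an element fixing everything outside \<open>(i, j)\<close> has sign 1 on the other three orbits and
  is therefore even.

  Lower bound: the supports of the slice turn \<open>R\<^sub>i\<close> and of \<open>U L\<^sub>j U\<^sup>-\<^sup>1\<close> meet in a single facelet,
  so their commutator is a 3-cycle in the orbit. If \<open>j\<close> is the middle index, then \<open>L\<^sub>j\<close> is not a
  generator; but turning the slices \<open>1, \<dots>, j\<close> is rotating the whole cube and turning the remaining
  slices back, so \<open>L\<^sub>j\<close> is a product of group elements and a cube rotation. It therefore normalises
  the group, and the commutator still belongs to it. Conjugating by slice turns shows that any two
  facelets of the orbit lie in a common such 3-cycle, which yields all 3-cycles.
\<close>

subsection \<open>Symmetric and alternating groups on a set\<close>

definition sym_group_on :: "'a set \<Rightarrow> ('a \<Rightarrow> 'a) monoid" where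
  "sym_group_on A = \<lparr>carrier = {p. p permutes A}, monoid.mult = (\<circ>), one = id\<rparr>"

definition even_permutations :: "'a set \<Rightarrow> ('a \<Rightarrow> 'a) set" where
  "even_permutations A = {p. p permutes A \<and> evenperm p}"

lemma sym_group_on_simps [simp]:
  "carrier (sym_group_on A) = {p. p permutes A}" "monoid.mult (sym_group_on A) = (\<circ>)"
  "one (sym_group_on A) = id"
  by (simp_all add: sym_group_on_def)

lemma group_sym_group_on: "group (sym_group_on A)"
proof (rule groupI)
  show "\<exists>q\<in>carrier (sym_group_on A). q \<otimes>\<^bsub>sym_group_on A\<^esub> p = \<one>\<^bsub>sym_group_on A\<^esub>"
    if "p \<in> carrier (sym_group_on A)" for p
    using that permutes_inv permutes_inv_o(2) by fastforce
qed (auto simp: permutes_compose comp_assoc)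

lemma inv_sym_group_on: "p permutes A \<Longrightarrow> inv\<^bsub>sym_group_on A\<^esub> p = inv' p"
  by (intro group.inv_equality[OF group_sym_group_on])
    (simp_all add: permutes_inv permutes_inv_o(2))

lemma permutes_if_invariant:
  assumes "f permutes A" "\<And>x. P (f x) \<longleftrightarrow> P x"
  shows "(\<lambda>x. if P x then f x else x) permutes A"
proof -
  have "P (inv' f x) \<longleftrightarrow> P x" for x
    using assms(2)[of "inv' f x"] permutes_inverses(1)[OF assms(1)] by simp
  then have "bij (\<lambda>x. if P x then f x else x)"
    by (intro o_bij[of "\<lambda>x. if P x then inv' f x else x"])
       (auto simp: fun_eq_iff permutes_inverses[OF assms(1)] assms(2))
  then show ?thesis
    using permutes_not_in[OF assms(1)] by (simp add: permutes_def bij_iff)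
qed

lemma subgroup_even_permutations:
  assumes "finite A" "A \<subseteq> B"
  shows "subgroup (even_permutations A) (sym_group_on B)"
proof (rule group.subgroupI[OF group_sym_group_on])
  show "even_permutations A \<noteq> {}"
    unfolding even_permutations_def using permutes_id[of A] evenperm_id by blast
  show even_sub: "even_permutations A \<subseteq> carrier (sym_group_on B)"
    using permutes_subset[OF _ assms(2)] by (auto simp: even_permutations_def)
  fix p assume p: "p \<in> even_permutations A"
  then show "inv\<^bsub>sym_group_on B\<^esub> p \<in> even_permutations A"
    using even_sub permutes_imp_permutation[OF assms(1)]
    by (auto simp: even_permutations_def inv_sym_group_on permutes_inv evenperm_inv)
  fix q assume "q \<in> even_permutations A"
  with p show "p \<otimes>\<^bsub>sym_group_on B\<^esub> q \<in> even_permutations A"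
    using permutes_imp_permutation[OF assms(1)]
    by (auto simp: even_permutations_def permutes_compose evenperm_comp)
qed

lemma alt_group_eq_even_permutations:
  "alt_group n = (sym_group_on {1..n})\<lparr>carrier := even_permutations {1..n}\<rparr>"
  by (simp add: alt_group_def sym_group_def sym_group_on_def even_permutations_def)

lemma map_permutation_iso:
  assumes "bij_betw f A B"
  shows "map_permutation A f \<in> iso (sym_group_on A) (sym_group_on B)"
proof -
  have "map_permutation A f = (\<lambda>p x. if x \<in> B then f (p (inv_into A f x)) else x)"
    using assms by (simp add: fun_eq_iff map_permutation_def restrict_id_def bij_betw_def)
  then have "bij_betw (map_permutation A f) {p. p permutes A} {p. p permutes B}"
    using bij_betw_permutations[OF assms] by simp
  then show ?thesis
    using assms by (auto simp: iso_def hom_def bij_betw_def map_permutation_compose')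
qed

lemma map_permutation_image_even_permutations:
  assumes "bij_betw f A B" "finite A"
  shows "map_permutation A f ` even_permutations A = even_permutations B"
proof -
  have perms: "map_permutation A f ` {p. p permutes A} = {p. p permutes B}"
    using map_permutation_iso[OF assms(1)] by (simp add: iso_def bij_betw_def)
  have parity: "evenperm (map_permutation A f p) \<longleftrightarrow> evenperm p" if "p permutes A" for p
    using assms that by (intro evenperm_map_permutation) (auto simp: bij_betw_def)
  show ?thesis
  proof
    show "map_permutation A f ` even_permutations A \<subseteq> even_permutations B"
      using perms parity by (auto simp: even_permutations_def)
    show "even_permutations B \<subseteq> map_permutation A f ` even_permutations A"
    proof
      fix q assume "q \<in> even_permutations B"
      then have "q permutes B" "evenperm q" by (simp_all add: even_permutations_def)
      moreover from this(1) obtain p where "p permutes A" "q = map_permutation A f p"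
        using perms by blast
      ultimately show "q \<in> map_permutation A f ` even_permutations A"
        using parity by (auto simp: even_permutations_def)
    qed
  qed
qed

lemma alt_group_card_iso:
  assumes "finite A"
  shows "alt_group (card A) \<cong> (sym_group_on A)\<lparr>carrier := even_permutations A\<rparr>"
proof -
  obtain e where e: "bij_betw e {1..card A} A"
    using ex_bij_betw_nat_finite_1[OF assms] by blast
  have "restrict (map_permutation {1..card A} e) (even_permutations {1..card A}) \<in>
      iso (alt_group (card A)) ((sym_group_on A)\<lparr>carrier := even_permutations A\<rparr>)"
    using iso_restrict[OF map_permutation_iso[OF e] group_sym_group_on group_sym_group_on
        subgroup_even_permutations[of "{1..card A}"]]
    unfolding map_permutation_image_even_permutations[OF e finite_atLeastAtMost]
      alt_group_eq_even_permutations by simp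
  then show ?thesis by (rule is_isoI)
qed

lemma restrict_iso_BijGroup:
  "(\<lambda>p. restrict p A) \<in> iso (sym_group_on A) (BijGroup A)"
proof (rule isoI)
  have Bij: "restrict p A \<in> Bij A" if "p permutes A" for p
    using permutes_imp_bij[OF that] by (simp add: Bij_def)
  show "(\<lambda>p. restrict p A) \<in> hom (sym_group_on A) (BijGroup A)"
  proof (rule homI)
    fix p q assume "p \<in> carrier (sym_group_on A)" "q \<in> carrier (sym_group_on A)"
    then have "p permutes A" "q permutes A" by simp_all
    then show "restrict (p \<otimes>\<^bsub>sym_group_on A\<^esub> q) A =
        restrict p A \<otimes>\<^bsub>BijGroup A\<^esub> restrict q A"
      by (auto simp: BijGroup_def Bij compose_def fun_eq_iff permutes_in_image)
  qed (simp add: BijGroup_def Bij)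
  have "bij_betw (\<lambda>p. restrict p A) {p. p permutes A} (Bij A)"
  proof (rule bij_betw_byWitness[where f' = "\<lambda>g. restrict_id g A"])
    show "\<forall>p \<in> {p. p permutes A}. restrict_id (restrict p A) A = p"
      by (auto simp: restrict_id_def fun_eq_iff permutes_not_in)
    show "\<forall>g \<in> Bij A. restrict (restrict_id g A) A = g"
      by (auto simp: restrict_id_def Bij_def fun_eq_iff extensional_def)
    show "(\<lambda>g. restrict_id g A) ` Bij A \<subseteq> {p. p permutes A}"
      by (auto simp: Bij_def intro: permutes_restrict_id)
  qed (use Bij in auto)
  then show "bij_betw (\<lambda>p. restrict p A) (carrier (sym_group_on A)) (carrier (BijGroup A))"
    by (simp add: BijGroup_def)
qed

lemma map_permutation_cycle_of_list:
  assumes "inj_on f A" "set cs \<subseteq> A"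
  shows "map_permutation A f (cycle_of_list cs) = cycle_of_list (map f cs)"
  using assms(2)
proof (induction cs rule: cycle_of_list.induct)
  case (1 i j cs)
  have "cycle_of_list (j # cs) permutes A"
    using 1(2) by (intro permutes_subset[OF cycle_permutes]) auto
  then have "map_permutation A f (cycle_of_list (i # j # cs)) =
      map_permutation A f (transpose i j) \<circ> map_permutation A f (cycle_of_list (j # cs))"
    unfolding cycle_of_list.simps(1) by (rule map_permutation_compose'[OF assms(1)])
  then show ?case
    using 1 by (simp add: map_permutation_transpose[OF assms(1)] del: comp_apply)
qed (simp_all add: map_permutation_id'[OF assms(1)])

lemma even_permutations_subset_if_three_cycles:
  assumes "subgroup H (sym_group_on A)" "finite S" "S \<subseteq> A"
    and cycles: "\<And>x y z. {x, y, z} \<subseteq> S \<Longrightarrow> distinct [x, y, z] \<Longrightarrow> cycle_of_list [x, y, z] \<in> H"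
  shows "even_permutations S \<subseteq> H"
proof -
  let ?alt = "alt_group (card S)"
  obtain e where e: "bij_betw e {1..card S} S"
    using ex_bij_betw_nat_finite_1[OF assms(2)] by blast
  then have inj: "inj_on e {1..card S}" and img: "e ` {1..card S} = S"
    by (simp_all add: bij_betw_def)
  let ?map = "map_permutation {1..card S} e"
  have "?map \<in> hom ?alt (sym_group_on A)"
    using permutes_subset[OF map_permutation_permutes[OF e] assms(3)]
      map_permutation_compose'[OF inj]
    by (intro homI) (auto simp: alt_group_carrier alt_group_mult simp del: One_nat_def)
  then interpret map: group_hom ?alt "sym_group_on A" ?map
    by (intro group_hom.intro alt_group_is_group group_sym_group_on)
       (simp add: group_hom_axioms_def)
  have "?map ` three_cycles (card S) \<subseteq> H"
  proof clarify
    fix cs :: "nat list" assume cs: "cycle cs" "length cs = 3" "set cs \<subseteq> {1..card S}"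
    then obtain a b c where abc: "cs = [a, b, c]"
      by (auto simp: numeral_3_eq_3 length_Suc_conv)
    have "cycle_of_list [e a, e b, e c] \<in> H"
      using cs inj img by (intro cycles) (auto simp: abc inj_on_eq_iff)
    then show "?map (cycle_of_list cs) \<in> H"
      using map_permutation_cycle_of_list[OF inj cs(3)] by (simp add: abc)
  qed
  then have "generate (sym_group_on A) (?map ` three_cycles (card S)) \<subseteq> H"
    using assms(1) by (rule map.H.generate_subgroup_incl)
  then have "?map ` carrier ?alt \<subseteq> H"
    unfolding alt_group_carrier_as_three_cycles map.generate_img[OF three_cycles_incl] .
  moreover have "carrier ?alt = even_permutations {1..card S}"
    by (simp add: alt_group_eq_even_permutations)
  ultimately show ?thesis
    using map_permutation_image_even_permutations[OF e finite_atLeastAtMost] by simp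
qed

lemma conj_comp:
  assumes "bij p" "bij q"
  shows "(p \<circ> q) \<circ> g \<circ> inv' (p \<circ> q) = p \<circ> (q \<circ> g \<circ> inv' q) \<circ> inv' p"
  using assms by (simp add: o_inv_distrib comp_assoc)

lemma conj_in_generate:
  assumes "p permutes A" "K \<subseteq> carrier (sym_group_on A)"
    and "\<And>h. h \<in> K \<Longrightarrow> p \<circ> h \<circ> inv' p \<in> K" and "g \<in> generate (sym_group_on A) K"
  shows "p \<circ> g \<circ> inv' p \<in> generate (sym_group_on A) K"
proof -
  let ?conj = "\<lambda>g. p \<circ> g \<circ> inv' p"
  have "?conj \<in> hom (sym_group_on A) (sym_group_on A)"
  proof (rule homI)
    show "?conj g \<in> carrier (sym_group_on A)" if "g \<in> carrier (sym_group_on A)" for g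
      using that assms(1) by (simp add: permutes_compose permutes_inv del: comp_apply)
    show "?conj (g \<otimes>\<^bsub>sym_group_on A\<^esub> h) = ?conj g \<otimes>\<^bsub>sym_group_on A\<^esub> ?conj h" for g h
      by (simp add: fun_eq_iff permutes_inverses[OF assms(1)])
  qed
  then interpret conj: group_hom "sym_group_on A" "sym_group_on A" ?conj
    by (intro group_hom.intro group_sym_group_on group_hom_axioms.intro)
  have "?conj g \<in> generate (sym_group_on A) (?conj ` K)"
    unfolding conj.generate_img[OF assms(2)] using assms(4) by (rule imageI)
  moreover have "?conj ` K \<subseteq> K" using assms(3) by blast
  ultimately show ?thesis using conj.G.mono_generate by blast
qed

subsection \<open>Three-cycles in a permutation group\<close>

lemma comp_eq_three_cycle_comp:
  assumes "inj a" "inj b" "a p \<noteq> p" "b p \<noteq> p"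
    and only_p: "\<And>x. a x \<noteq> x \<Longrightarrow> b x \<noteq> x \<Longrightarrow> x = p"
  shows "a \<circ> b = cycle_of_list [p, a p, b p] \<circ> (b \<circ> a)"
proof
  fix x
  let ?c = "cycle_of_list [p, a p, b p]"
  note inj = inj_eq[OF assms(1)] inj_eq[OF assms(2)]
  have b_ap: "b (a p) = a p" and a_bp: "a (b p) = b p"
    using only_p[of "a p"] only_p[of "b p"] assms(3,4) inj by auto
  then have "distinct [p, a p, b p]" using assms(3,4) inj by auto
  then have c_cycle: "?c p = a p" "?c (a p) = b p" "?c (b p) = p" by auto
  have c_fixed: "?c y = y" if "y \<noteq> p" "y \<noteq> a p" "y \<noteq> b p" for y
    using that by (intro id_outside_supp) simp
  consider (is_p) "x = p" | (moved_by_a) "x \<noteq> p" "a x \<noteq> x"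
    | (moved_by_b) "a x = x" "b x \<noteq> x" | (unmoved) "x \<noteq> p" "a x = x" "b x = x"
    by blast
  then have "a (b x) = ?c (b (a x))"
  proof cases
    case is_p
    then show ?thesis using a_bp b_ap c_cycle(2) by simp
  next
    case moved_by_a
    then have "b x = x" using only_p by blast
    then show ?thesis
      using moved_by_a c_cycle(3) c_fixed[of "a x"] only_p[of "a x"] a_bp inj by metis
  next
    case moved_by_b
    then show ?thesis
      using c_cycle(1) c_fixed[of "b x"] only_p[of "b x"] b_ap inj by metis
  next
    case unmoved
    then show ?thesis using c_fixed[of x] a_bp b_ap inj by metis
  qed
  then show "(a \<circ> b) x = (?c \<circ> (b \<circ> a)) x" by simp
qed

lemma commutator_three_cycle:
  assumes "bij a" "bij b" "a p \<noteq> p" "b p \<noteq> p"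
    and "\<And>x. a x \<noteq> x \<Longrightarrow> b x \<noteq> x \<Longrightarrow> x = p"
  shows "a \<circ> b \<circ> inv' a \<circ> inv' b = cycle_of_list [p, a p, b p]"
proof -
  let ?c = "cycle_of_list [p, a p, b p]"
  have "a \<circ> b = ?c \<circ> (b \<circ> a)"
    using assms by (intro comp_eq_three_cycle_comp bij_is_inj)
  then have "a \<circ> b \<circ> inv' a \<circ> inv' b = ?c \<circ> (b \<circ> (a \<circ> inv' a) \<circ> inv' b)"
    by (simp add: comp_assoc del: cycle_of_list.simps)
  also have "\<dots> = ?c"
    using assms(1,2) by (simp add: surj_iff[THEN iffD1] bij_is_surj del: cycle_of_list.simps)
  finally show ?thesis .
qed

locale permutation_group = subgroup H "sym_group_on A" for H :: "('a \<Rightarrow> 'a) set" and A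
begin

lemma permutes: "p \<in> H \<Longrightarrow> p permutes A"
  using subset by auto

lemma comp_closed: "p \<in> H \<Longrightarrow> q \<in> H \<Longrightarrow> p \<circ> q \<in> H"
  using m_closed by simp

lemma inv_closed: "p \<in> H \<Longrightarrow> inv' p \<in> H"
  using m_inv_closed inv_sym_group_on[OF permutes] by metis

lemma commutator_closed:
  assumes "p \<in> H" "\<And>h. h \<in> H \<Longrightarrow> q \<circ> h \<circ> inv' q \<in> H"
  shows "p \<circ> q \<circ> inv' p \<circ> inv' q \<in> H"
  using comp_closed[OF assms(1) assms(2)[OF inv_closed[OF assms(1)]]] by (simp add: comp_assoc)

definition has_three_cycle :: "'a \<Rightarrow> 'a \<Rightarrow> 'a \<Rightarrow> bool" where
  "has_three_cycle x y z \<longleftrightarrow> distinct [x, y, z] \<and> cycle_of_list [x, y, z] \<in> H"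

definition linked :: "'a \<Rightarrow> 'a \<Rightarrow> bool" where
  "linked x y \<longleftrightarrow> x = y \<or> (\<exists>z. has_three_cycle x y z)"

lemma has_three_cycle_rotate: "has_three_cycle x y z \<Longrightarrow> has_three_cycle y z x"
  using cycle_of_list_rotate_independent[of "[x, y, z]" 1]
  by (auto simp: has_three_cycle_def simp del: cycle_of_list.simps)

lemma has_three_cycle_reverse:
  assumes "has_three_cycle x y z"
  shows "has_three_cycle z y x"
proof -
  have "inv' (cycle_of_list [x, y, z]) = cycle_of_list [z, y, x]"
    by (intro inv_unique_comp)
       (simp_all add: fun_eq_iff transpose_commute[of z y] transpose_commute[of y x])
  then show ?thesis
    using assms inv_closed[of "cycle_of_list [x, y, z]"]
    by (auto simp: has_three_cycle_def simp del: cycle_of_list.simps)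
qed

lemma has_three_cycle_image:
  assumes "g \<in> H" "has_three_cycle x y z"
  shows "has_three_cycle (g x) (g y) (g z)"
proof -
  have "bij g" using permutes[OF assms(1)] by (rule permutes_bij)
  then have "cycle_of_list [g x, g y, g z] = g \<circ> cycle_of_list [x, y, z] \<circ> inv' g"
    using assms(2) conjugation_of_cycle[of "[x, y, z]" g]
    by (simp add: has_three_cycle_def del: cycle_of_list.simps)
  then show ?thesis
    using assms comp_closed inv_closed inj_eq[OF bij_is_inj[OF \<open>bij g\<close>]]
    by (simp add: has_three_cycle_def del: cycle_of_list.simps)
qed

lemma has_three_cycle_if_common_pair:
  assumes "has_three_cycle w x y" "has_three_cycle w x z" "y \<noteq> z"
  shows "has_three_cycle x y z"
proof -
  let ?g = "cycle_of_list [w, x, y]"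
  have "?g w = x" "?g x = y" "?g z = z"
    using assms by (auto simp: has_three_cycle_def)
  then show ?thesis
    using has_three_cycle_image[OF _ assms(2), of ?g] assms(1)
    by (simp add: has_three_cycle_def del: cycle_of_list.simps)
qed

lemma has_three_cycle_if_common_point:
  assumes xyu: "has_three_cycle x y u" and yzv: "has_three_cycle y z v" and "x \<noteq> z"
  shows "has_three_cycle x y z"
proof -
  consider (u_eq_z) "u = z" | (v_eq_x) "v = x" | (u_eq_v) "u = v"
    | (distinct) "u \<noteq> v" "u \<noteq> z" "v \<noteq> x"
    by blast
  then show ?thesis
  proof cases
    case u_eq_z
    then show ?thesis using xyu by simp
  next
    case v_eq_x
    then show ?thesis using yzv has_three_cycle_rotate by blast
  next
    case u_eq_v
    have "has_three_cycle u y x" "has_three_cycle u y z"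
      using has_three_cycle_reverse[OF xyu] has_three_cycle_rotate yzv u_eq_v by blast+
    then have "has_three_cycle y x z" using assms(3) by (rule has_three_cycle_if_common_pair)
    then show ?thesis using has_three_cycle_reverse has_three_cycle_rotate by blast
  next
    case distinct
    let ?g = "cycle_of_list [y, z, v]"
    have "?g x = x" "?g y = z" "?g u = u"
      using xyu yzv assms(3) distinct by (auto simp: has_three_cycle_def)
    then have "has_three_cycle x z u"
      using has_three_cycle_image[OF _ xyu, of ?g] yzv
      by (simp add: has_three_cycle_def del: cycle_of_list.simps)
    then have "has_three_cycle u x y" "has_three_cycle u x z"
      using xyu has_three_cycle_rotate by blast+
    moreover have "y \<noteq> z" using yzv by (simp add: has_three_cycle_def)
    ultimately show ?thesis by (rule has_three_cycle_if_common_pair)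
  qed
qed

lemma linked_sym: "linked x y \<Longrightarrow> linked y x"
  unfolding linked_def using has_three_cycle_reverse has_three_cycle_rotate by blast

lemma has_three_cycle_if_linked:
  assumes "linked x y" "linked y z" "distinct [x, y, z]"
  shows "has_three_cycle x y z"
  using assms has_three_cycle_if_common_point by (auto simp: linked_def)

lemma linked_trans:
  assumes "linked x y" "linked y z"
  shows "linked x z"
proof (cases "distinct [x, y, z]")
  case True
  then have "has_three_cycle x y z" using assms by (intro has_three_cycle_if_linked)
  then have "has_three_cycle x z y"
    using has_three_cycle_reverse has_three_cycle_rotate by blast
  then show ?thesis by (auto simp: linked_def)
qed (use assms in \<open>auto simp: linked_def\<close>)

lemma linked_image: "g \<in> H \<Longrightarrow> linked x y \<Longrightarrow> linked (g x) (g y)"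
  using has_three_cycle_image unfolding linked_def by blast

lemma even_permutations_subset_if_linked:
  assumes "finite S" "S \<subseteq> A" "\<And>x y. x \<in> S \<Longrightarrow> y \<in> S \<Longrightarrow> linked x y"
  shows "even_permutations S \<subseteq> H"
  using subgroup_axioms assms(1,2)
proof (rule even_permutations_subset_if_three_cycles)
  fix x y z assume "{x, y, z} \<subseteq> S" "distinct [x, y, z]"
  then have "has_three_cycle x y z" using assms(3) by (intro has_three_cycle_if_linked) auto
  then show "cycle_of_list [x, y, z] \<in> H" by (simp add: has_three_cycle_def)
qed

end

subsection \<open>Parity\<close>

lemma sign_cycle_of_list: "cycle cs \<Longrightarrow> sign (cycle_of_list cs) = (-1) ^ (length cs - 1)"
proof (induction cs rule: cycle_of_list.induct)
  case (1 i j cs)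
  then have "sign (cycle_of_list (i # j # cs)) =
      sign (transpose i j) * sign (cycle_of_list (j # cs))"
    by (simp only: cycle_of_list.simps sign_compose permutation_swap_id permutation_of_cycle)
  then show ?case using 1 by (simp add: sign_swap_id del: cycle_of_list.simps)
qed simp_all

lemma funpow_cycle_of_list_hd:
  assumes "cycle cs" "cs \<noteq> []"
  shows "(cycle_of_list cs ^^ m) (hd cs) = cs ! (m mod length cs)"
proof -
  have "(cycle_of_list cs ^^ m) (hd cs) = hd (map (cycle_of_list cs ^^ m) cs)"
    using assms(2) by (simp add: hd_map)
  also have "\<dots> = cs ! (m mod length cs)"
    using assms by (simp add: cyclic_rotation hd_rotate_conv_nth)
  finally show ?thesis .
qed

lemma least_power_cycle_of_list_hd:
  assumes "cycle cs" "cs \<noteq> []"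
  shows "least_power (cycle_of_list cs) (hd cs) = length cs"
  unfolding least_power_def
proof (rule Least_equality)
  show "(cycle_of_list cs ^^ length cs) (hd cs) = hd cs \<and> 0 < length cs"
    using assms cycle_is_id_root[OF assms(1)] by simp
  fix m assume m: "(cycle_of_list cs ^^ m) (hd cs) = hd cs \<and> 0 < m"
  then have "cs ! (m mod length cs) = cs ! 0"
    using assms funpow_cycle_of_list_hd[OF assms, of m] by (simp add: hd_conv_nth)
  then have "m mod length cs = 0" using assms by (simp add: nth_eq_iff_index_eq)
  then show "length cs \<le> m" using m by (auto intro: dvd_imp_le)
qed

lemma least_power_cong_on:
  assumes "p ` S \<subseteq> S" "\<And>x. x \<in> S \<Longrightarrow> q x = p x" "x \<in> S"
  shows "least_power q x = least_power p x"
proof -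
  have "(q ^^ m) x = (p ^^ m) x \<and> (p ^^ m) x \<in> S" for m
    using assms by (induction m) auto
  then show ?thesis by (simp add: least_power_def)
qed

lemma least_power_eq_4:
  assumes "p (p (p (p x))) = x" "p (p x) \<noteq> x"
  shows "least_power p x = 4"
  unfolding least_power_def
proof (rule Least_equality)
  fix m assume m: "(p ^^ m) x = x \<and> 0 < m"
  have "m \<noteq> 1" "m \<noteq> 2" "m \<noteq> 3" using m assms by (auto simp: numeral_eq_Suc)
  then show "4 \<le> m" using m by linarith
qed (use assms in \<open>simp add: numeral_eq_Suc\<close>)

lemma cycle_decomp_finite: "cycle_decomp I p \<Longrightarrow> finite I"
  by (induction rule: cycle_decomp.induct) auto

lemma cycle_decomp_permutes: "cycle_decomp I p \<Longrightarrow> p permutes I"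
proof (induction rule: cycle_decomp.induct)
  case (comp I p cs)
  then have "p permutes set cs \<union> I" "cycle_of_list cs permutes set cs \<union> I"
    using permutes_subset[OF _ Un_upper2] permutes_subset[OF cycle_permutes Un_upper1] by blast+
  then show ?case by (rule permutes_compose)
qed (rule permutes_id)

lemma cycle_comp_disjoint_apply:
  assumes "p permutes I" "set cs \<inter> I = {}"
  shows "x \<in> I \<Longrightarrow> (cycle_of_list cs \<circ> p) x = p x"
    and "x \<in> set cs \<Longrightarrow> (cycle_of_list cs \<circ> p) x = cycle_of_list cs x"
proof -
  assume "x \<in> I"
  then have "p x \<notin> set cs" using assms permutes_in_image[OF assms(1)] by blast
  then show "(cycle_of_list cs \<circ> p) x = p x" by (simp add: id_outside_supp)
next
  assume "x \<in> set cs"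
  then have "p x = x" using assms permutes_not_in[OF assms(1)] by blast
  then show "(cycle_of_list cs \<circ> p) x = cycle_of_list cs x" by simp
qed

lemma sign_if_uniform_cycles:
  assumes "finite A" "p permutes A" "\<And>x. x \<in> A \<Longrightarrow> least_power p x = k"
  shows "\<exists>m. card A = k * m \<and> sign p = (-1) ^ ((k - 1) * m)"
  using cycle_decomposition[OF assms(2,1)] assms(3)
proof (induction rule: cycle_decomp.induct)
  case empty
  show ?case by (intro exI[of _ 0]) simp
next
  case (comp I p cs)
  let ?c = "cycle_of_list cs" and ?q = "cycle_of_list cs \<circ> p"
  have p: "p permutes I" using comp.hyps(1) by (rule cycle_decomp_permutes)
  note q_apply = cycle_comp_disjoint_apply[OF p comp.hyps(3)]
  have "least_power p x = k" if "x \<in> I" for x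
    using that comp.prems[of x] least_power_cong_on[of p I ?q x] permutes_image[OF p] q_apply(1)
    by (simp del: comp_apply)
  then obtain m where card_I: "card I = k * m" and sign_p: "sign p = (-1) ^ ((k - 1) * m)"
    using comp.IH by blast
  show ?case
  proof (cases "cs = []")
    case True
    then show ?thesis using card_I sign_p by auto
  next
    case False
    have k: "k = length cs"
      using False comp.prems[of "hd cs"] least_power_cycle_of_list_hd[OF comp.hyps(2)]
        cycle_is_surj[OF comp.hyps(2)] least_power_cong_on[of ?c "set cs" ?q "hd cs"] q_apply(2)
      by (simp del: comp_apply)
    have "finite I" using comp.hyps(1) by (rule cycle_decomp_finite)
    then have "card (set cs \<union> I) = k * Suc m"
      using comp.hyps(2,3) card_I by (simp add: card_Un_disjoint distinct_card k)
    moreover have "sign ?q = sign ?c * sign p"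
      using permutation_of_cycle permutes_imp_permutation[OF \<open>finite I\<close> p] by (rule sign_compose)
    then have "sign ?q = (-1) ^ ((k - 1) * Suc m)"
      using sign_p by (simp add: sign_cycle_of_list[OF comp.hyps(2)] k power_add)
    ultimately show ?thesis by blast
  qed
qed

lemma sign_on_inv:
  assumes "bij f" "f ` B = B" "finite B"
  shows "sign_on B (inv' f) = sign_on B f"
proof -
  have f: "bij_betw f B B"
    using assms(1) subset_UNIV assms(2) by (rule bij_betw_subset)
  have "inv' f ` B = B"
    using image_inv_f_f[OF bij_is_inj[OF assms(1)], of B] assms(2) by simp
  with bij_imp_bij_inv[OF assms(1)] subset_UNIV have "bij_betw (inv' f) B B"
    by (rule bij_betw_subset)
  then have "sign_on B (inv' f \<circ> f) = sign_on B (inv' f) * sign_on B f"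
    using f assms(3) by (intro sign_on_compose)
  then show ?thesis
    using assms(1) by (auto simp: bij_is_inj sign_on_def sign_def split: if_splits)
qed

lemma generate_sym_group_on_image_eq:
  assumes "g \<in> generate (sym_group_on A) K" "\<And>h. h \<in> K \<Longrightarrow> h permutes A \<and> h ` B = B"
  shows "g permutes A \<and> g ` B = B"
  using assms(1)
proof (induction rule: generate.induct)
  case (inv h)
  then have "h permutes A" "h ` B = B" using assms(2) by auto
  then have "inv' h ` B = B" using image_inv_f_f[OF permutes_inj, of h A B] by simp
  then show ?case using \<open>h permutes A\<close> by (simp add: inv_sym_group_on permutes_inv)
next
  case (eng h1 h2)
  then have "h1 \<circ> h2 permutes A" "(h1 \<circ> h2) ` B = B"
    by (simp_all only: permutes_compose image_comp[symmetric])
  then show ?case by (simp del: comp_apply)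
next
  case one
  show ?case unfolding sym_group_on_simps by (intro conjI permutes_id) simp
qed (use assms(2) in simp)

lemma prod_sign_on_generate_eq_1:
  assumes "g \<in> generate (sym_group_on A) K"
    and K_stabilizes: "\<And>h. h \<in> K \<Longrightarrow> h permutes A" "\<And>h s. h \<in> K \<Longrightarrow> s \<in> I \<Longrightarrow> h ` B s = B s"
    and finite_B: "\<And>s. s \<in> I \<Longrightarrow> finite (B s)"
    and sign_eq_1: "\<And>h. h \<in> K \<Longrightarrow> (\<Prod>s\<in>I. sign_on (B s) h) = 1"
  shows "(\<Prod>s\<in>I. sign_on (B s) g) = 1"
  using assms(1)
proof (induction rule: generate.induct)
  case (inv h)
  then have "sign_on (B s) (inv' h) = sign_on (B s) h" if "s \<in> I" for s
    using that K_stabilizes finite_B by (intro sign_on_inv permutes_bij) auto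
  then show ?case using inv K_stabilizes(1) sign_eq_1 by (simp add: inv_sym_group_on)
next
  case (eng h1 h2)
  have "bij_betw h (B s) (B s)" if "h \<in> generate (sym_group_on A) K" "s \<in> I" for h s
    using generate_sym_group_on_image_eq[OF that(1), of "B s"] K_stabilizes that(2)
    by (auto intro!: bij_betw_subset[OF permutes_bij subset_UNIV])
  then have "sign_on (B s) (h1 \<circ> h2) = sign_on (B s) h1 * sign_on (B s) h2" if "s \<in> I" for s
    using that eng.hyps finite_B by (intro sign_on_compose) auto
  then show ?case using eng.IH by (simp add: prod.distrib del: comp_apply)
qed (simp_all add: sign_eq_1)

lemma permutes_bij_betw_finite_subset:
  assumes "p permutes A" "finite S" "\<And>x. x \<in> S \<Longrightarrow> p x \<in> S"
  shows "bij_betw p S S"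
  using permutes_inj_on[OF assms(1)] assms(2,3)
  by (intro bij_betw_imageI endo_inj_surj) auto

subsection \<open>Slices as layers of the cube\<close>

fun opposite :: "face \<Rightarrow> face" where
  "opposite Up = Down" | "opposite Down = Up"
| "opposite Front = Back" | "opposite Back = Front"
| "opposite Left = Right" | "opposite Right = Left"

fun layer :: "nat \<Rightarrow> face \<Rightarrow> facelet \<Rightarrow> nat" where
  "layer n Up (f, r, c) = (case f of Up \<Rightarrow> 1 | Down \<Rightarrow> n | _ \<Rightarrow> r)"
| "layer n Down (f, r, c) = (case f of Down \<Rightarrow> 1 | Up \<Rightarrow> n | _ \<Rightarrow> n + 1 - r)"
| "layer n Front (f, r, c) =
    (case f of Front \<Rightarrow> 1 | Back \<Rightarrow> n | Up \<Rightarrow> n + 1 - r | Right \<Rightarrow> c | Down \<Rightarrow> r | Left \<Rightarrow> n + 1 - c)"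
| "layer n Back (f, r, c) =
    (case f of Back \<Rightarrow> 1 | Front \<Rightarrow> n | Up \<Rightarrow> r | Right \<Rightarrow> n + 1 - c | Down \<Rightarrow> n + 1 - r | Left \<Rightarrow> c)"
| "layer n Left (f, r, c) = (case f of Left \<Rightarrow> 1 | Right \<Rightarrow> n | Back \<Rightarrow> n + 1 - c | _ \<Rightarrow> c)"
| "layer n Right (f, r, c) = (case f of Right \<Rightarrow> 1 | Left \<Rightarrow> n | Back \<Rightarrow> c | _ \<Rightarrow> n + 1 - c)"

fun rotate_face :: "face \<Rightarrow> face \<Rightarrow> face" where
  "rotate_face Up f =
    (case f of Front \<Rightarrow> Left | Left \<Rightarrow> Back | Back \<Rightarrow> Right | Right \<Rightarrow> Front | _ \<Rightarrow> f)"
| "rotate_face Down f =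
    (case f of Front \<Rightarrow> Right | Right \<Rightarrow> Back | Back \<Rightarrow> Left | Left \<Rightarrow> Front | _ \<Rightarrow> f)"
| "rotate_face Front f =
    (case f of Up \<Rightarrow> Right | Right \<Rightarrow> Down | Down \<Rightarrow> Left | Left \<Rightarrow> Up | _ \<Rightarrow> f)"
| "rotate_face Back f =
    (case f of Up \<Rightarrow> Left | Left \<Rightarrow> Down | Down \<Rightarrow> Right | Right \<Rightarrow> Up | _ \<Rightarrow> f)"
| "rotate_face Right f =
    (case f of Front \<Rightarrow> Up | Up \<Rightarrow> Back | Back \<Rightarrow> Down | Down \<Rightarrow> Front | _ \<Rightarrow> f)"
| "rotate_face Left f =
    (case f of Front \<Rightarrow> Down | Down \<Rightarrow> Back | Back \<Rightarrow> Up | Up \<Rightarrow> Front | _ \<Rightarrow> f)"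

text \<open>In the usual net the grids of Up, Front and Down are aligned along a rotation about Left or
  Right, while that of Back is upside down; along a rotation about Front or Back each of the four
  grids is a quarter turn of its predecessor.\<close>

definition rotate_position :: "nat \<Rightarrow> face \<Rightarrow> face \<Rightarrow> nat \<Rightarrow> nat \<Rightarrow> nat \<times> nat" where
  "rotate_position n X f r c =
    (if X = Front \<and> f \<noteq> Back \<or> f = X then (c, n + 1 - r)
     else if X = Back \<or> f = opposite X then (n + 1 - c, r)
     else if X \<in> {Left, Right} \<and> Back \<in> {f, rotate_face X f} then (n + 1 - r, n + 1 - c)
     else (r, c))"

definition cube_rotation :: "nat \<Rightarrow> face \<Rightarrow> facelet \<Rightarrow> facelet" where
  "cube_rotation n X =
    restrict_id (\<lambda>(f, r, c). (rotate_face X f, rotate_position n X f r c)) (facelets n)"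

definition turn :: "nat \<Rightarrow> face \<Rightarrow> nat \<Rightarrow> facelet \<Rightarrow> facelet" where
  "turn n X k = restrict_id (slice_turn n X k) (facelets n)"

lemma mem_facelets_iff: "(f, r, c) \<in> facelets n \<longleftrightarrow> 1 \<le> r \<and> r \<le> n \<and> 1 \<le> c \<and> c \<le> n"
  by (auto simp: facelets_def)

lemma UNIV_face: "UNIV = {Up, Down, Front, Back, Right, Left}"
  using face.exhaust by auto

lemma opposite_opposite [simp]: "opposite (opposite X) = X"
  by (cases X) simp_all

lemma layer_opposite: "x \<in> facelets n \<Longrightarrow> layer n (opposite X) x = n + 1 - layer n X x"
  by (cases x; cases X; cases "fst x") (auto simp: mem_facelets_iff)

lemma layer_bounds: "x \<in> facelets n \<Longrightarrow> 1 \<le> layer n X x \<and> layer n X x \<le> n"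
  by (cases x; cases X; cases "fst x") (auto simp: mem_facelets_iff)

lemma facelets_cases:
  assumes "x \<in> facelets n"
  obtains (coordinates) f r c where "x = (f, r, c)"
    "\<And>g. (g, r, c) \<in> facelets n" "\<And>g. (g, c, n + 1 - r) \<in> facelets n"
    "\<And>g. (g, n + 1 - r, n + 1 - c) \<in> facelets n" "\<And>g. (g, n + 1 - c, r) \<in> facelets n"
    "n + 1 - (n + 1 - r) = r" "n + 1 - (n + 1 - c) = c"
proof -
  obtain f r c where x: "x = (f, r, c)" by (cases x)
  then show thesis by (rule that) (use assms in \<open>auto simp: x mem_facelets_iff\<close>)
qed

lemma cube_rotation_apply:
  "(f, r, c) \<in> facelets n \<Longrightarrow>
    cube_rotation n X (f, r, c) = (rotate_face X f, rotate_position n X f r c)"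
  by (simp add: cube_rotation_def)

lemma cube_rotation_outside: "x \<notin> facelets n \<Longrightarrow> cube_rotation n X x = x"
  by (simp add: cube_rotation_def)

lemma cube_rotation_in_facelets:
  assumes "x \<in> facelets n"
  shows "cube_rotation n X x \<in> facelets n"
  using assms
proof (cases rule: facelets_cases)
  case (coordinates f r c)
  show ?thesis
    unfolding coordinates(1)
    by (cases X; cases f)
       (simp_all add: coordinates(2-)[simplified] cube_rotation_apply rotate_position_def)
qed

lemma cube_rotation_opposite: "cube_rotation n (opposite X) (cube_rotation n X x) = x"
proof (cases "x \<in> facelets n")
  case True
  then show ?thesis
  proof (cases rule: facelets_cases)
    case (coordinates f r c)
    show ?thesis
      unfolding coordinates(1)
      by (cases X; cases f)
         (simp_all add: coordinates(2-)[simplified] cube_rotation_apply rotate_position_def)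
  qed
qed (simp add: cube_rotation_outside)

lemma cube_rotation_4:
  "cube_rotation n X (cube_rotation n X (cube_rotation n X (cube_rotation n X x))) = x"
proof (cases "x \<in> facelets n")
  case True
  then show ?thesis
  proof (cases rule: facelets_cases)
    case (coordinates f r c)
    show ?thesis
      unfolding coordinates(1)
      by (cases X; cases f)
         (simp_all add: coordinates(2-)[simplified] cube_rotation_apply rotate_position_def)
  qed
qed (simp add: cube_rotation_outside)

lemma cube_rotation_twice_neq:
  assumes "(f, r, c) \<in> facelets n" "(n + 1 - r, n + 1 - c) \<noteq> (r, c)"
  shows "cube_rotation n X (cube_rotation n X (f, r, c)) \<noteq> (f, r, c)"
  using assms(1)
proof (cases rule: facelets_cases)
  case (coordinates g s d)
  then show ?thesis
    using assms(2)
    by (cases X; cases g)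
       (simp_all add: coordinates(2-)[simplified] cube_rotation_apply rotate_position_def)
qed

lemma layer_rotate_face:
  assumes "x \<in> facelets n"
  shows "layer n (rotate_face Y X) (cube_rotation n Y x) = layer n X x"
  using assms
proof (cases rule: facelets_cases)
  case (coordinates f r c)
  show ?thesis
    unfolding coordinates(1)
    by (cases Y; cases f; cases X)
       (simp_all add: coordinates(2-)[simplified] cube_rotation_apply rotate_position_def)
qed

lemma cube_rotation_rotate_face:
  "cube_rotation n (rotate_face Y X) (cube_rotation n Y x) =
    cube_rotation n Y (cube_rotation n X x)"
proof (cases "x \<in> facelets n")
  case True
  then show ?thesis
  proof (cases rule: facelets_cases)
    case (coordinates f r c)
    show ?thesis
      unfolding coordinates(1)
      by (cases Y; cases f; cases X)
         (simp_all add: coordinates(2-)[simplified] cube_rotation_apply rotate_position_def)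
  qed
qed (simp add: cube_rotation_outside)

lemma turn_eq_cube_rotation:
  assumes "1 \<le> k" "k < n"
  shows "turn n X k x = (if layer n X x = k then cube_rotation n X x else x)"
proof (cases "x \<in> facelets n")
  case True
  obtain f r c where x: "x = (f, r, c)" by (cases x)
  show ?thesis
    using True assms unfolding x
    by (cases X; cases f)
       (auto simp: turn_def cube_rotation_apply rotate_position_def slice_turn_def mem_facelets_iff)
qed (simp add: turn_def cube_rotation_outside)

lemma rotate_face_same [simp]: "rotate_face X X = X"
  by (cases X) simp_all

lemma layer_cube_rotation: "layer n X (cube_rotation n X x) = layer n X x"
  using layer_rotate_face[of x n X X]
  by (cases "x \<in> facelets n") (simp_all add: cube_rotation_outside)

lemma cube_rotation_permutes: "cube_rotation n X permutes facelets n"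
proof (rule bij_imp_permutes)
  show "bij_betw (cube_rotation n X) (facelets n) (facelets n)"
    using cube_rotation_opposite[of n X] cube_rotation_opposite[of n "opposite X"]
    by (intro bij_betw_byWitness[where f' = "cube_rotation n (opposite X)"])
       (auto intro: cube_rotation_in_facelets)
qed (rule cube_rotation_outside)

lemma turn_permutes:
  assumes "1 \<le> k" "k < n"
  shows "turn n X k permutes facelets n"
proof -
  have "turn n X k = (\<lambda>x. if layer n X x = k then cube_rotation n X x else x)"
    using turn_eq_cube_rotation[OF assms] by blast
  then show ?thesis
    using permutes_if_invariant[OF cube_rotation_permutes] layer_cube_rotation by simp
qed

lemma bij_turn: "1 \<le> k \<Longrightarrow> k < n \<Longrightarrow> bij (turn n X k)"
  using turn_permutes by (rule permutes_bij)

lemma turn_eq_if: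
  assumes "1 \<le> k" "k < n"
  shows "turn n X k (f, r, c) =
    (if (f, r, c) \<in> facelets n \<and> layer n X (f, r, c) = k
     then (rotate_face X f, rotate_position n X f r c) else (f, r, c))"
  using assms by (simp add: turn_eq_cube_rotation cube_rotation_apply cube_rotation_outside)

lemma turn_own_face:
  assumes "(f, r, c) \<in> facelets n" "1 < n"
  shows "turn n f 1 (f, r, c) = (f, c, n + 1 - r)"
proof -
  have "layer n f (f, r, c) = 1" by (cases f) simp_all
  then show ?thesis using assms by (simp add: turn_eq_if rotate_position_def)
qed

primrec turns :: "nat \<Rightarrow> face \<Rightarrow> nat \<Rightarrow> facelet \<Rightarrow> facelet" where
  "turns n X 0 = id"
| "turns n X (Suc k) = turn n X (Suc k) \<circ> turns n X k"

lemma turns_eq_cube_rotation: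
  "k < n \<Longrightarrow> turns n X k x = (if layer n X x \<le> k then cube_rotation n X x else x)"
proof (induction k)
  case 0
  then show ?case
    using layer_bounds[of x n X] cube_rotation_outside[of x n X] by (cases "x \<in> facelets n") auto
next
  case (Suc k)
  then show ?case
    by (simp add: turn_eq_cube_rotation layer_cube_rotation)
qed

lemma turns_complement:
  assumes "1 \<le> k" "k < n"
  shows "turns n X k = turns n (opposite X) (n - k) \<circ> cube_rotation n X"
proof
  fix x
  show "turns n X k x = (turns n (opposite X) (n - k) \<circ> cube_rotation n X) x"
  proof (cases "x \<in> facelets n")
    case True
    have "layer n (opposite X) (cube_rotation n X x) = n + 1 - layer n X x"
      using layer_opposite[OF cube_rotation_in_facelets[OF True]] by (simp add: layer_cube_rotation)
    then show ?thesis
      using assms layer_bounds[OF True, of X]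
      by (auto simp: turns_eq_cube_rotation cube_rotation_opposite)
  qed (use assms in \<open>simp add: turns_eq_cube_rotation cube_rotation_outside\<close>)
qed

lemma cube_rotation_comp_turn:
  assumes "1 \<le> k" "k < n"
  shows "cube_rotation n Y \<circ> turn n X k = turn n (rotate_face Y X) k \<circ> cube_rotation n Y"
proof
  fix x
  show "(cube_rotation n Y \<circ> turn n X k) x = (turn n (rotate_face Y X) k \<circ> cube_rotation n Y) x"
    using layer_rotate_face[of x n Y X] cube_rotation_rotate_face[of n Y X x]
    by (cases "x \<in> facelets n")
       (auto simp: turn_eq_cube_rotation[OF assms] cube_rotation_outside)
qed

subsection \<open>The Rubik's Cube group as a permutation group\<close>

definition quarter_turns :: "nat \<Rightarrow> (facelet \<Rightarrow> facelet) set" where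
  "quarter_turns n = {turn n X k | X k. 1 \<le> k \<and> k \<le> n div 2}"

definition moves :: "nat \<Rightarrow> (facelet \<Rightarrow> facelet) set" where
  "moves n = generate (sym_group_on (facelets n)) (quarter_turns n)"

lemma quarter_turns_subset: "quarter_turns n \<subseteq> carrier (sym_group_on (facelets n))"
  using turn_permutes by (auto simp: quarter_turns_def)

interpretation moves: permutation_group "moves n" "facelets n" for n
  unfolding permutation_group_def moves_def
  using quarter_turns_subset by (rule group.generate_is_subgroup[OF group_sym_group_on])

lemma turn_in_moves: "1 \<le> k \<Longrightarrow> k \<le> n div 2 \<Longrightarrow> turn n X k \<in> moves n"
  unfolding moves_def quarter_turns_def by (rule generate.incl) blast

lemma carrier_rubik_group_eq_moves:
  "carrier (rubik_group n) = (\<lambda>g. restrict g (facelets n)) ` moves n"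
proof -
  let ?restrict = "\<lambda>g. restrict g (facelets n)"
  have "?restrict \<in> hom (sym_group_on (facelets n)) (BijGroup (facelets n))"
    using restrict_iso_BijGroup by (rule iso_imp_homomorphism)
  then interpret restrict: group_hom "sym_group_on (facelets n)" "BijGroup (facelets n)" ?restrict
    by (intro group_hom.intro group_sym_group_on group_BijGroup group_hom_axioms.intro)
  have "?restrict (turn n X k) = ?restrict (slice_turn n X k)" for X k
    by (auto simp: turn_def)
  moreover have "?restrict ` {turn n X k | X k. 1 \<le> k \<and> k \<le> n div 2} =
      {?restrict (turn n X k) | X k. 1 \<le> k \<and> k \<le> n div 2}"
    by blast
  ultimately have "?restrict ` quarter_turns n = slice_turns n"
    by (simp only: slice_turns_def quarter_turns_def)
  then show ?thesis
    using restrict.generate_img[OF quarter_turns_subset]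
    by (simp add: carrier_rubik_group moves_def)
qed

lemma cube_rotation_normalizes_moves:
  assumes "g \<in> moves n"
  shows "cube_rotation n X \<circ> g \<circ> inv' (cube_rotation n X) \<in> moves n"
  unfolding moves_def
proof (rule conj_in_generate)
  fix h assume "h \<in> quarter_turns n"
  then obtain Y k where k: "1 \<le> k" "k \<le> n div 2" and h: "h = turn n Y k"
    by (auto simp: quarter_turns_def)
  have "cube_rotation n X \<circ> h \<circ> inv' (cube_rotation n X) =
      turn n (rotate_face X Y) k \<circ> (cube_rotation n X \<circ> inv' (cube_rotation n X))"
    using k by (simp add: h cube_rotation_comp_turn comp_assoc)
  also have "\<dots> = turn n (rotate_face X Y) k"
    using permutes_inv_o(1)[OF cube_rotation_permutes] by simp
  finally show "cube_rotation n X \<circ> h \<circ> inv' (cube_rotation n X) \<in> quarter_turns n"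
    using k by (auto simp: quarter_turns_def)
qed (use cube_rotation_permutes quarter_turns_subset assms[unfolded moves_def] in auto)

lemma turns_in_moves: "k \<le> n div 2 \<Longrightarrow> turns n X k \<in> moves n"
proof (induction k)
  case 0
  show ?case using moves.one_closed unfolding sym_group_on_simps turns.simps .
next
  case (Suc k)
  then show ?case unfolding turns.simps by (intro moves.comp_closed turn_in_moves) auto
qed

lemma turn_normalizes_moves:
  assumes "g \<in> moves n" "2 \<le> n" "1 \<le> k" "k \<le> (n + 1) div 2"
  shows "turn n X k \<circ> g \<circ> inv' (turn n X k) \<in> moves n"
proof (cases "k \<le> n div 2")
  case True
  then show ?thesis using assms by (intro moves.comp_closed moves.inv_closed turn_in_moves)
next
  case False
  let ?t = "turn n X k" and ?r = "cube_rotation n X"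
  let ?a = "turns n X (k - 1)" and ?b = "turns n (opposite X) (n - k)"
  have k_range: "k < n" "k - 1 \<le> n div 2" "n - k \<le> n div 2" using False assms(2,4) by auto
  have a: "?a \<in> moves n" and b: "?b \<in> moves n" using k_range turns_in_moves by auto
  have perms: "?a permutes facelets n" "?b permutes facelets n" "?r permutes facelets n"
    using a b moves.permutes cube_rotation_permutes by auto
  have "?t \<circ> ?a = ?b \<circ> ?r"
    using turns_complement[OF assms(3) k_range(1), of X] assms(3) by (cases k) simp_all
  then have t: "?t = ?b \<circ> (?r \<circ> inv' ?a)"
    using permutes_inv_o(1)[OF perms(1)] by (metis comp_assoc comp_id)
  have "?t \<circ> g \<circ> inv' ?t =
      ?b \<circ> (?r \<circ> (inv' ?a \<circ> g \<circ> inv' (inv' ?a)) \<circ> inv' ?r) \<circ> inv' ?b"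
    unfolding t using perms[THEN permutes_bij]
    by (simp only: conj_comp bij_comp bij_imp_bij_inv)
  also have "\<dots> \<in> moves n"
    using a b assms(1)
    by (intro moves.comp_closed moves.inv_closed cube_rotation_normalizes_moves)
  finally show ?thesis .
qed

subsection \<open>Parity of slice turns on a center edge orbit\<close>

definition grid_rotations :: "nat \<Rightarrow> nat \<Rightarrow> nat \<Rightarrow> (nat \<times> nat) set" where
  "grid_rotations n r c = {(r, c), (c, n + 1 - r), (n + 1 - r, n + 1 - c), (n + 1 - c, r)}"

lemma center_edge_orbit_eq: "center_edge_orbit n a b = UNIV \<times> grid_rotations n a b"
  by (simp add: center_edge_orbit_def grid_rotations_def)

lemma grid_rotations_eq:
  assumes "1 \<le> a" "a \<le> n" "1 \<le> b" "b \<le> n" and "(r, c) \<in> grid_rotations n a b"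
  shows "grid_rotations n r c = grid_rotations n a b"
proof -
  have reflect: "n + 1 - (n + 1 - a) = a" "n + 1 - (n + 1 - b) = b" using assms by auto
  consider "r = a" "c = b" | "r = b" "c = n + 1 - a" | "r = n + 1 - a" "c = n + 1 - b"
    | "r = n + 1 - b" "c = a"
    using assms(5) unfolding grid_rotations_def by blast
  then show ?thesis
    unfolding grid_rotations_def by cases (simp_all only: reflect insert_commute)
qed

lemma rotate_position_in_grid_rotations: "rotate_position n X f r c \<in> grid_rotations n r c"
  by (simp add: rotate_position_def grid_rotations_def)

lemma center_edge_orbit_subset:
  "1 \<le> a \<Longrightarrow> a \<le> n \<Longrightarrow> 1 \<le> b \<Longrightarrow> b \<le> n \<Longrightarrow> center_edge_orbit n a b \<subseteq> facelets n"
  by (auto simp: center_edge_orbit_def facelets_def)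

lemma finite_center_edge_orbit: "finite (center_edge_orbit n a b)"
  by (simp add: center_edge_orbit_def UNIV_face)

lemma cube_rotation_in_center_edge_orbit:
  assumes "1 \<le> a" "a \<le> n" "1 \<le> b" "b \<le> n" and "x \<in> center_edge_orbit n a b"
  shows "cube_rotation n X x \<in> center_edge_orbit n a b"
proof -
  obtain f r c where x: "x = (f, r, c)" by (cases x)
  have "(f, r, c) \<in> facelets n" using center_edge_orbit_subset assms x by blast
  moreover have "(r, c) \<in> grid_rotations n a b"
    using assms(5) by (simp add: x center_edge_orbit_eq)
  then have "rotate_position n X f r c \<in> grid_rotations n a b"
    using rotate_position_in_grid_rotations grid_rotations_eq[OF assms(1-4)] by blast
  ultimately show ?thesis
    by (simp add: x cube_rotation_apply center_edge_orbit_eq)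
qed

lemma least_power_cube_rotation:
  assumes "1 \<le> a" "a \<le> n div 2" "1 \<le> b" "b \<le> n" and "x \<in> center_edge_orbit n a b"
  shows "least_power (cube_rotation n X) x = 4"
proof (rule least_power_eq_4)
  obtain f r c where x: "x = (f, r, c)" by (cases x)
  have "(n + 1 - r, n + 1 - c) \<noteq> (r, c)"
    using assms x by (auto simp: center_edge_orbit_def)
  moreover have "center_edge_orbit n a b \<subseteq> facelets n"
    using assms by (intro center_edge_orbit_subset) auto
  then have "x \<in> facelets n" using assms(5) by blast
  ultimately show "cube_rotation n X (cube_rotation n X x) \<noteq> x"
    unfolding x by (intro cube_rotation_twice_neq)
qed (rule cube_rotation_4)

lemma card_layer_center_edge_orbit:
  assumes a_range: "1 \<le> a" "a \<le> n div 2" and b_range: "1 \<le> b" "b \<le> (n + 1) div 2"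
    and k_range: "1 \<le> k" "k \<le> n div 2"
  shows "card {x \<in> center_edge_orbit n a b. layer n X x = k} =
    4 * (of_bool (a = k) + of_bool (b = k) + of_bool (1 = k))"
proof -
  let ?in_layer = "\<lambda>x. of_bool (layer n X x = k) :: nat"
  have "card {x \<in> center_edge_orbit n a b. layer n X x = k} =
      (\<Sum>x \<in> center_edge_orbit n a b. ?in_layer x)"
    using finite_center_edge_orbit[of n a b] by (simp add: sum_of_bool_eq Int_def)
  also have "\<dots> = (\<Sum>f\<in>UNIV. \<Sum>q\<in>grid_rotations n a b. ?in_layer (f, q))"
    unfolding center_edge_orbit_eq sum.cartesian_product by (intro sum.cong) auto
  also have "\<dots> = (\<Sum>f\<in>UNIV. ?in_layer (f, a, b) + ?in_layer (f, b, n + 1 - a) +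
      ?in_layer (f, n + 1 - a, n + 1 - b) + ?in_layer (f, n + 1 - b, a))"
  proof -
    have "a \<noteq> n + 1 - a" "a = b \<Longrightarrow> b \<noteq> n + 1 - a" "b = n + 1 - b \<Longrightarrow> b \<noteq> a"
      using a_range b_range by auto
    then show ?thesis
      using a_range b_range unfolding grid_rotations_def by (intro sum.cong refl) auto
  qed
  also have "\<dots> = 4 * (of_bool (a = k) + of_bool (b = k) + of_bool (1 = k))"
  proof -
    have "n + 1 - a \<noteq> k" "n + 1 - b \<noteq> k" "n \<noteq> k"
      "n + 1 - (n + 1 - a) = a" "n + 1 - (n + 1 - b) = b"
      using a_range b_range k_range by auto
    then show ?thesis by (cases X) (simp_all add: UNIV_face)
  qed
  finally show ?thesis .
qed

lemma sign_on_turn: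
  assumes a_range: "1 \<le> a" "a \<le> n div 2" and b_range: "1 \<le> b" "b \<le> (n + 1) div 2"
    and k_range: "1 \<le> k" "k \<le> n div 2"
  shows "sign_on (center_edge_orbit n a b) (turn n X k) =
    (-1) ^ (of_bool (a = k) + of_bool (b = k) + of_bool (1 = k))"
proof -
  let ?layer = "{x \<in> center_edge_orbit n a b. layer n X x = k}"
  let ?p = "restrict_id (cube_rotation n X) ?layer"
  have le_n: "a \<le> n" "b \<le> n" "k < n" using a_range b_range k_range by auto
  have in_layer: "cube_rotation n X x \<in> ?layer" if "x \<in> ?layer" for x
    using that cube_rotation_in_center_edge_orbit[OF a_range(1) le_n(1) b_range(1) le_n(2)]
    by (simp add: layer_cube_rotation)
  have finite_layer: "finite ?layer" using finite_center_edge_orbit by simp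
  have perm: "?p permutes ?layer"
    using permutes_bij_betw_finite_subset[OF cube_rotation_permutes finite_layer in_layer]
    by (rule permutes_restrict_id)
  have "least_power ?p x = 4" if "x \<in> ?layer" for x
  proof -
    have "cube_rotation n X ` ?layer \<subseteq> ?layer" using in_layer by blast
    then have "least_power ?p x = least_power (cube_rotation n X) x"
      using restrict_id_simps(1) that by (rule least_power_cong_on)
    then show ?thesis
      using least_power_cube_rotation[OF a_range b_range(1) le_n(2)] that by simp
  qed
  then obtain m where card_layer: "card ?layer = 4 * m" and sign_p: "sign ?p = (-1) ^ (3 * m)"
    using sign_if_uniform_cycles[OF finite_layer perm, of 4] by auto
  have "restrict_id (turn n X k) (center_edge_orbit n a b) = ?p"
    by (auto simp: fun_eq_iff restrict_id_def turn_eq_cube_rotation[OF k_range(1) le_n(3)])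
  then have "sign_on (center_edge_orbit n a b) (turn n X k) = (-1) ^ m"
    using sign_p by (simp add: sign_on_def power_mult)
  moreover have "m = of_bool (a = k) + of_bool (b = k) + of_bool (1 = k)"
    using card_layer card_layer_center_edge_orbit[OF a_range b_range k_range] by simp
  ultimately show ?thesis by (simp only:)
qed

lemma turn_image_center_edge_orbit:
  assumes "1 \<le> a" "a \<le> n" "1 \<le> b" "b \<le> n" "1 \<le> k" "k < n"
  shows "turn n X k ` center_edge_orbit n a b = center_edge_orbit n a b"
proof (intro bij_betw_imp_surj_on permutes_bij_betw_finite_subset)
  show "turn n X k permutes facelets n" using assms(5,6) by (rule turn_permutes)
  show "turn n X k x \<in> center_edge_orbit n a b" if "x \<in> center_edge_orbit n a b" for x
    using cube_rotation_in_center_edge_orbit[OF assms(1-4) that] that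
    by (simp add: turn_eq_cube_rotation[OF assms(5,6)])
qed (rule finite_center_edge_orbit)

locale center_edge =
  fixes n i j :: nat
  assumes five_le_n: "n \<ge> 5" and i_range: "2 \<le> i" "i \<le> n div 2"
    and j_range: "2 \<le> j" "j \<le> (n + 1) div 2" and j_neq_i: "j \<noteq> i"
begin

abbreviation orb :: "facelet set" where "orb \<equiv> center_edge_orbit n i j"

lemma orb_subset: "orb \<subseteq> facelets n"
  using five_le_n i_range j_range by (intro center_edge_orbit_subset) auto

lemma prod_sign_on_orbits_moves:
  assumes "g \<in> moves n"
  shows "sign_on orb g * sign_on (center_edge_orbit n 1 1) g * sign_on (center_edge_orbit n 1 i) g *
    sign_on (center_edge_orbit n 1 j) g = 1"
proof -
  let ?I = "{(i, j), (1, 1), (1, i), (1, j)}" and ?orbit = "\<lambda>s. center_edge_orbit n (fst s) (snd s)"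
  have I_range: "1 \<le> fst s \<and> fst s \<le> n div 2 \<and> 1 \<le> snd s \<and> snd s \<le> (n + 1) div 2" if "s \<in> ?I" for s
    using that five_le_n i_range j_range by auto
  have "(\<Prod>s\<in>?I. sign_on (?orbit s) g) = 1"
    using assms unfolding moves_def
  proof (rule prod_sign_on_generate_eq_1)
    fix h assume "h \<in> quarter_turns n"
    then obtain X k where k: "1 \<le> k" "k \<le> n div 2" and h: "h = turn n X k"
      by (auto simp: quarter_turns_def)
    have "k < n" using k by auto
    then show "h permutes facelets n" unfolding h using k(1) by (intro turn_permutes)
    show "h ` ?orbit s = ?orbit s" if "s \<in> ?I" for s
      unfolding h using I_range[OF that] k(1) \<open>k < n\<close>
      by (intro turn_image_center_edge_orbit) linarith+
    let ?e = "\<lambda>x. (-1) ^ of_bool (x = k) :: int"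
    have "(\<Prod>s\<in>?I. sign_on (?orbit s) h) = (\<Prod>s\<in>?I. ?e (fst s) * ?e (snd s) * ?e 1)"
      unfolding h using I_range k by (intro prod.cong refl) (simp only: sign_on_turn power_add)
    also have "\<dots> = (?e i * ?e j * ?e 1) * (?e 1 * ?e 1 * ?e 1) *
        (?e 1 * ?e i * ?e 1) * (?e 1 * ?e j * ?e 1)"
      using i_range j_range j_neq_i by simp
    also have "\<dots> = 1" by (simp add: of_bool_def)
    finally show "(\<Prod>s\<in>?I. sign_on (?orbit s) h) = 1" .
  qed (rule finite_center_edge_orbit)
  then show ?thesis using i_range j_range j_neq_i by simp
qed

lemma evenperm_if_moves_permutes_orb:
  assumes "g \<in> moves n" "g permutes orb"
  shows "evenperm g"
proof -
  have "sign_on (center_edge_orbit n 1 b) g = sign_on (center_edge_orbit n 1 b) id"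
    if "1 \<le> b" "b \<le> (n + 1) div 2" for b
  proof (rule sign_on_cong[OF refl])
    fix x assume "x \<in> center_edge_orbit n 1 b"
    then have "x \<notin> orb" using that five_le_n i_range j_range by (auto simp: center_edge_orbit_def)
    then show "g x = id x" using permutes_not_in[OF assms(2)] by simp
  qed
  then have "sign_on orb g = 1"
    using prod_sign_on_orbits_moves[OF assms(1)] five_le_n i_range j_range j_neq_i by simp
  then show ?thesis
    using sign_on_permutes[OF assms(2) order_refl] by (simp add: sign_def split: if_splits)
qed

lemma index_bounds: "1 \<le> i" "i < n" "1 \<le> j" "j < n" "1 < n"
  using five_le_n i_range j_range by auto

definition conjugate_turn :: "facelet \<Rightarrow> facelet" where
  "conjugate_turn = turn n Up 1 \<circ> turn n Left j \<circ> inv' (turn n Up 1)"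

lemma bij_conjugate_turn: "bij conjugate_turn"
  unfolding conjugate_turn_def using index_bounds by (intro bij_comp bij_imp_bij_inv bij_turn) auto

lemma conjugate_turn_apply: "conjugate_turn (turn n Up 1 x) = turn n Up 1 (turn n Left j x)"
  using bij_turn[OF order_refl index_bounds(5)] by (simp add: conjugate_turn_def bij_is_inj)

lemma conjugate_turn_normalizes_moves:
  assumes "g \<in> moves n"
  shows "conjugate_turn \<circ> g \<circ> inv' conjugate_turn \<in> moves n"
proof -
  let ?u = "turn n Up 1" and ?l = "turn n Left j"
  have u: "?u \<in> moves n" using five_le_n by (intro turn_in_moves) auto
  have "inv' ?u \<circ> g \<circ> inv' (inv' ?u) \<in> moves n"
    using u assms by (intro moves.comp_closed moves.inv_closed)
  then have l_conj: "?l \<circ> (inv' ?u \<circ> g \<circ> inv' (inv' ?u)) \<circ> inv' ?l \<in> moves n"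
    by (rule turn_normalizes_moves) (use five_le_n j_range in auto)
  have "conjugate_turn \<circ> g \<circ> inv' conjugate_turn =
      ?u \<circ> (?l \<circ> (inv' ?u \<circ> g \<circ> inv' (inv' ?u)) \<circ> inv' ?l) \<circ> inv' ?u"
    using bij_turn[OF order_refl index_bounds(5), of Up] bij_turn[OF index_bounds(3,4), of Left]
    unfolding conjugate_turn_def by (simp only: conj_comp bij_comp bij_imp_bij_inv)
  then show ?thesis
    using moves.comp_closed[OF moves.comp_closed[OF u l_conj] moves.inv_closed[OF u]]
    by (simp only:)
qed

lemma conjugate_turn_unique_common_moved:
  assumes "turn n Right i x \<noteq> x" "conjugate_turn x \<noteq> x"
  shows "x = turn n Up 1 (Up, i, j)"
proof -
  obtain y where x: "x = turn n Up 1 y"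
    using bij_is_surj[OF bij_turn[OF order_refl index_bounds(5)]] by (rule surjE)
  have left_neq: "turn n Left j y \<noteq> y" using assms(2) unfolding x conjugate_turn_apply by metis
  then have left: "layer n Left y = j"
    using turn_eq_cube_rotation index_bounds by metis
  have right: "layer n Right (turn n Up 1 y) = i"
    using assms(1) turn_eq_cube_rotation index_bounds unfolding x by metis
  obtain f r c where y: "y = (f, r, c)" by (cases y)
  have "(f, r, c) \<in> facelets n"
    using left_neq turn_permutes[of j n Left] index_bounds permutes_not_in y by metis
  then have "y = (Up, i, j)"
    using left right index_bounds i_range j_range j_neq_i unfolding y mem_facelets_iff
    by (cases f) (auto simp: turn_eq_if rotate_position_def mem_facelets_iff split: if_splits)
  then show ?thesis by (simp add: x)
qed

lemma has_three_cycle_orb: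
  "moves.has_three_cycle n (Up, j, n + 1 - i) (Back, n + 1 - j, i) (Front, i, j)"
proof -
  let ?a = "turn n Right i" and ?b = conjugate_turn and ?p = "turn n Up 1 (Up, i, j)"
  have mem: "(Up, i, j) \<in> facelets n" "(Front, i, j) \<in> facelets n" "(Up, j, n + 1 - i) \<in> facelets n"
    using orb_subset by (auto simp: center_edge_orbit_def)
  have p: "?p = (Up, j, n + 1 - i)"
    using mem index_bounds by (simp add: turn_eq_if rotate_position_def)
  have "n + 1 - (n + 1 - i) = i" using index_bounds by simp
  then have a: "?a ?p = (Back, n + 1 - j, i)"
    using mem index_bounds unfolding p by (simp add: turn_eq_if rotate_position_def)
  have b: "?b ?p = (Front, i, j)"
    unfolding conjugate_turn_apply using mem index_bounds i_range(1)
    by (simp add: turn_eq_if rotate_position_def)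
  have "?a \<in> moves n" using i_range by (intro turn_in_moves) auto
  then have "?a \<circ> ?b \<circ> inv' ?a \<circ> inv' ?b \<in> moves n"
    using conjugate_turn_normalizes_moves by (rule moves.commutator_closed)
  moreover have "?a \<circ> ?b \<circ> inv' ?a \<circ> inv' ?b = cycle_of_list [?p, ?a ?p, ?b ?p]"
    using bij_turn[OF index_bounds(1,2)] bij_conjugate_turn
  proof (rule commutator_three_cycle)
    show "?a ?p \<noteq> ?p" "?b ?p \<noteq> ?p" unfolding a b unfolding p by simp_all
  qed (rule conjugate_turn_unique_common_moved)
  ultimately show ?thesis
    unfolding moves.has_three_cycle_def a b unfolding p by simp
qed

lemma layer_orb_eq_1_iff:
  assumes "x \<in> orb"
  shows "layer n X x = 1 \<longleftrightarrow> fst x = X"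
proof -
  obtain f r c where x: "x = (f, r, c)" by (cases x)
  have "1 < r" "r < n" "1 < c" "c < n"
    using assms five_le_n i_range j_range by (auto simp: x center_edge_orbit_def)
  then show ?thesis unfolding x by (cases X; cases f) auto
qed

lemma linked_same_face:
  assumes "moves.linked n x y" "x \<in> orb" "y \<in> orb" "fst x \<noteq> fst y"
    and "x' \<in> orb" "fst x' = fst x"
  shows "moves.linked n x' y"
proof -
  obtain f r c where x: "x = (f, r, c)" by (cases x)
  have "turn n f 1 \<in> moves n" using five_le_n by (intro turn_in_moves) auto
  moreover have "turn n f 1 y = y"
    using assms(3,4) x layer_orb_eq_1_iff[OF assms(3), of f] index_bounds(5)
    by (simp add: turn_eq_cube_rotation)
  ultimately have turn_link: "moves.linked n (f, c', n + 1 - r') y"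
    if "moves.linked n (f, r', c') y" "(f, r', c') \<in> facelets n" for r' c'
    using moves.linked_image[OF _ that(1), of "turn n f 1"]
      turn_own_face[OF that(2) index_bounds(5)] by simp
  have mem: "(f, r, c) \<in> facelets n" "(f, c, n + 1 - r) \<in> facelets n"
    "(f, n + 1 - r, n + 1 - c) \<in> facelets n" and reflect: "n + 1 - (n + 1 - r) = r"
    using assms(2) orb_subset x by (auto simp: mem_facelets_iff dest!: subsetD)
  have quarter: "moves.linked n (f, c, n + 1 - r) y"
    using assms(1) mem(1) unfolding x by (rule turn_link)
  then have half: "moves.linked n (f, n + 1 - r, n + 1 - c) y"
    using mem(2) by (rule turn_link)
  have three_quarters: "moves.linked n (f, n + 1 - c, r) y"
    using turn_link[OF half mem(3)] unfolding reflect .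
  obtain q where x': "x' = (f, q)" using assms(6) x by (cases x') simp
  have "grid_rotations n r c = grid_rotations n i j"
    using index_bounds assms(2) by (intro grid_rotations_eq) (auto simp: x center_edge_orbit_eq)
  then have "q \<in> grid_rotations n r c" using assms(5) by (simp add: x' center_edge_orbit_eq)
  then show ?thesis
    using assms(1) quarter half three_quarters unfolding x x' grid_rotations_def by blast
qed

lemma ex_orb_on_face_in_layer:
  assumes "f \<notin> {X, opposite X}" "k \<in> {i, j}"
  shows "\<exists>x \<in> orb. fst x = f \<and> layer n X x = k"
proof -
  have "n + 1 - (n + 1 - i) = i" "n + 1 - (n + 1 - j) = j" using index_bounds by auto
  then have "\<exists>q \<in> grid_rotations n i j. layer n X (f, q) = k"
    using assms by (cases X; cases f) (auto simp: grid_rotations_def)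
  then show ?thesis by (force simp: center_edge_orbit_eq)
qed

definition face_linked_to :: "facelet \<Rightarrow> face \<Rightarrow> bool" where
  "face_linked_to z f \<longleftrightarrow> (\<forall>x \<in> orb. fst x = f \<longrightarrow> moves.linked n x z)"

lemma face_linked_to_rotate_face:
  assumes "face_linked_to z f" "f \<notin> {X, opposite X}"
  shows "face_linked_to z (rotate_face X f)"
proof -
  obtain x y where x: "x \<in> orb" "fst x = f" "layer n X x = i"
    and y: "y \<in> orb" "fst y = f" "layer n X y = j"
    using ex_orb_on_face_in_layer[OF assms(2)] by blast
  have xz: "moves.linked n x z" and yz: "moves.linked n y z"
    using assms(1) x y by (auto simp: face_linked_to_def)
  let ?t = "turn n X i"
  have "?t \<in> moves n" using i_range by (intro turn_in_moves) auto
  then have "moves.linked n (?t x) (?t y)"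
    using moves.linked_trans[OF xz moves.linked_sym[OF yz]] by (rule moves.linked_image)
  moreover have "?t x = cube_rotation n X x" "?t y = y"
    using x(3) y(3) j_neq_i by (simp_all add: turn_eq_cube_rotation[OF index_bounds(1,2)])
  ultimately have linked: "moves.linked n (cube_rotation n X x) y" by simp
  have orb: "cube_rotation n X x \<in> orb"
    using x(1) index_bounds by (intro cube_rotation_in_center_edge_orbit) auto
  have face: "fst (cube_rotation n X x) = rotate_face X f"
    using x(1,2) orb_subset by (cases x) (auto simp: cube_rotation_apply)
  have "rotate_face X f \<noteq> f" using assms(2) by (cases X; cases f) auto
  then have "moves.linked n x' y" if "x' \<in> orb" "fst x' = rotate_face X f" for x'
    using linked_same_face[OF linked orb y(1) _ that(1)] that(2) face y(2) by simp
  then show ?thesis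
    using yz moves.linked_trans unfolding face_linked_to_def by blast
qed

lemma linked_orb:
  assumes "x \<in> orb" "y \<in> orb"
  shows "moves.linked n x y"
proof -
  let ?z = "(Back, n + 1 - j, i) :: facelet"
  have mem: "(Up, j, n + 1 - i) \<in> orb" "?z \<in> orb" by (simp_all add: center_edge_orbit_def)
  have "moves.linked n (Up, j, n + 1 - i) ?z"
    using has_three_cycle_orb unfolding moves.linked_def by blast
  then have linked_up: "face_linked_to ?z Up"
    using linked_same_face[OF _ mem] by (simp add: face_linked_to_def)
  note rotate = face_linked_to_rotate_face
  have linked_front: "face_linked_to ?z Front" using rotate[OF linked_up, of Left] by simp
  have linked_down: "face_linked_to ?z Down" using rotate[OF linked_front, of Left] by simp
  have linked_back: "face_linked_to ?z Back" using rotate[OF linked_down, of Left] by simp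
  have linked_right: "face_linked_to ?z Right" using rotate[OF linked_up, of Front] by simp
  have linked_left: "face_linked_to ?z Left" using rotate[OF linked_up, of Back] by simp
  have "face_linked_to ?z f" for f
    using linked_up linked_front linked_down linked_back linked_right linked_left
    by (cases f) simp_all
  then have "moves.linked n x ?z" "moves.linked n y ?z"
    using assms by (auto simp: face_linked_to_def)
  then show ?thesis using moves.linked_trans moves.linked_sym by blast
qed

lemma moves_permuting_orb: "{g \<in> moves n. g permutes orb} = even_permutations orb"
proof
  show "{g \<in> moves n. g permutes orb} \<subseteq> even_permutations orb"
    using evenperm_if_moves_permutes_orb by (auto simp: even_permutations_def)
  have "even_permutations orb \<subseteq> moves n"
    using finite_center_edge_orbit orb_subset linked_orb
    by (rule moves.even_permutations_subset_if_linked)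
  then show "even_permutations orb \<subseteq> {g \<in> moves n. g permutes orb}"
    by (auto simp: even_permutations_def)
qed

lemma Z_center_edge_eq_even_permutations:
  "Z_center_edge n i j = (\<lambda>g. restrict g (facelets n)) ` even_permutations orb"
proof -
  have "(\<forall>x \<in> facelets n - orb. restrict g (facelets n) x = x) \<longleftrightarrow> g permutes orb"
    if "g \<in> moves n" for g
    using permutes_superset[OF moves.permutes[OF that]] permutes_not_in[of g orb] by auto
  then show ?thesis
    unfolding Z_center_edge_def carrier_rubik_group_eq_moves moves_permuting_orb[symmetric] by blast
qed

lemma card_orb: "card orb = 24"
proof -
  have "card (grid_rotations n i j) = 4"
    using five_le_n i_range j_range j_neq_i by (auto simp: grid_rotations_def card_insert_if)
  moreover have "card (UNIV :: face set) = 6" by (simp add: UNIV_face)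
  ultimately show ?thesis unfolding center_edge_orbit_eq card_cartesian_product by simp
qed

lemma even_permutations_orb_iso_Z_center_edge:
  "(sym_group_on orb)\<lparr>carrier := even_permutations orb\<rparr> \<cong>
    (rubik_group n)\<lparr>carrier := Z_center_edge n i j\<rparr>"
proof -
  have Z: "(rubik_group n)\<lparr>carrier := Z_center_edge n i j\<rparr> = (BijGroup (facelets n))\<lparr>carrier :=
      (\<lambda>g. restrict g (facelets n)) ` even_permutations orb\<rparr>"
    by (simp add: rubik_group_def subgroup_generated_def Z_center_edge_eq_even_permutations)
  have sym: "(sym_group_on orb)\<lparr>carrier := even_permutations orb\<rparr> =
      (sym_group_on (facelets n))\<lparr>carrier := even_permutations orb\<rparr>"
    by (simp add: sym_group_on_def)
  have "subgroup (even_permutations orb) (sym_group_on (facelets n))"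
    using finite_center_edge_orbit orb_subset by (rule subgroup_even_permutations)
  then show ?thesis
    unfolding Z sym
    by (rule is_isoI[OF iso_restrict[OF restrict_iso_BijGroup group_sym_group_on group_BijGroup]])
qed

end

theorem theorem13:
  fixes n i j :: nat
  assumes "n \<ge> 5"
    and "2 \<le> i" and "i \<le> n div 2"
    and "2 \<le> j" and "j \<le> (n + 1) div 2"
    and "j \<noteq> i"
  shows "(rubik_group n)\<lparr>carrier := Z_center_edge n i j\<rparr> \<cong> alt_group 24"
proof -
  interpret center_edge n i j using assms by unfold_locales
  have "alt_group 24 \<cong> (sym_group_on orb)\<lparr>carrier := even_permutations orb\<rparr>"
    using alt_group_card_iso[OF finite_center_edge_orbit] card_orb by metis
  then have "alt_group 24 \<cong> (rubik_group n)\<lparr>carrier := Z_center_edge n i j\<rparr>"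
    using even_permutations_orb_iso_Z_center_edge by (rule iso_trans)
  then show ?thesis by (rule group.iso_sym[OF alt_group_is_group])
qed

end
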